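(* Let $N>1$, let $X_0\in\mathcal X$, and suppose $E_0:=\Psi(X_0)<G_0\,\varphi(r)$. Suppose that $\nabla\Psi$ is $L$-Lipschitz continuous on $\mathcal X$ for some $L>0$, and let $0<\Delta t\le\frac1L$. Let $(X_n)_{n\ge0}$ be the discrete trajectory computed by $$X^i_{n+1}=X^i_n-\Delta t\,(\nabla\Psi(X_n))_i,\qquad i=1,\dots,N,\ n\ge0,$$ and assume the robots remain in the domain, i.e. $X_n^i\in\Omega$ for all $i$ and $n$. Then for all $n\ge 0$ $$\inf_{i\neq j}\|X_n^i-X_n^j\|^2>r^2 .$$
   Context: $N$ robots have positions $X=(X^1,\dots,X^N)$ with $X^i\in\mathbb R^2$, identified with points of $\mathbb R^{2N}$; norms are Euclidean; $(\nabla\Psi(X))_i\in\mathbb R^2$ is the gradient of $\Psi$ with respect to $X^i$. Constants: $0<r<R$, $G_0>0$, $M>0$, and $\Omega=[-M,M]^2$. The set of admissible configurations is $$\mathcal X=\{(X^1,\dots,X^N): X^i\in\Omega \text{ for all } i,\ \inf_{i,\,j\ne i}\|X^i-X^j\|>r\}.$$ The potential is $\Psi=F+G$, where: - $F:(\mathbb R^2)^N\to[0,\infty)$ is continuously differentiable, bounded on $\Omega^N$, and attains its minimum only at configurations in the desired target region. - $G$ is the repelling function $$G(X)=G_0\sum_{i=1}^N\sum_{\substack{j\neq i\\ \|X^i-X^j\|<R}}\varphi(\|X^i-X^j\|),$$ where $\varphi\in C^1(0,\infty)$ is a decreasing function with $\lim_{x\to R^-}\varphi(x)=\lim_{x\to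 R^-}\varphi'(x)=0$. Pairs at distance at least $R$ contribute $0$. The function $G$ is defined on configurations with pairwise distinct points. *)

theory Defs
  imports "HOL-Analysis.Analysis"
begin

text \<open>
  A configuration of the robots indexed by the finite type \<open>'n\<close> is an element of
  \<^typ>\<open>real ^ 2 ^ 'n\<close>; its library norm is the Euclidean norm of \<open>\<real>\<^sup>2\<^sup>N\<close>, where
  \<open>N = CARD('n)\<close>, and \<open>X $ i\<close> is the position of robot \<open>i\<close>.
\<close>

type_synonym 'n config = "real ^ 2 ^ 'n"

definition Omega :: "real \<Rightarrow> (real ^ 2) set" where
  "Omega M = {x. \<forall>k. x $ k \<in> {-M..M}}"

definition Omega_configs :: "real \<Rightarrow> 'n::finite config set" where
  "Omega_configs M = {X. \<forall>i. X $ i \<in> Omega M}"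

definition robot_pairs :: "('n \<times> 'n) set" where
  "robot_pairs = {(i, j). j \<noteq> i}"

text \<open>
  The infimum ranges over a nonempty set exactly when there are at least two robots;
  for a single robot it is an unspecified real number.
\<close>

definition admissible :: "real \<Rightarrow> real \<Rightarrow> 'n::finite config set" where
  "admissible M r =
     {X. (\<forall>i. X $ i \<in> Omega M) \<and> (INF (i, j) \<in> robot_pairs. norm (X $ i - X $ j)) > r}"

text \<open>
  The repelling function is only meaningful on configurations with pairwise distinct
  points; at other configurations the formula involves the irrelevant value \<open>\<phi> 0\<close>.
  Such configurations are never limits of admissible ones when \<open>r > 0\<close>.
\<close>

definition repelling :: "real \<Rightarrow> real \<Rightarrow> (real \<Rightarrow> real) \<Rightarrow> 'n::finite config \<Rightarrow> real" where
  "repelling G0 R \<phi> X =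
     G0 * (\<Sum>i\<in>UNIV. \<Sum>j\<in>{j. j \<noteq> i \<and> norm (X $ i - X $ j) < R}. \<phi> (norm (X $ i - X $ j)))"

definition potential ::
  "('n::finite config \<Rightarrow> real) \<Rightarrow> real \<Rightarrow> real \<Rightarrow> (real \<Rightarrow> real) \<Rightarrow> 'n config \<Rightarrow> real" where
  "potential F G0 R \<phi> X = F X + repelling G0 R \<phi> X"

text \<open>The gradient, unspecified at points where the function is not differentiable.\<close>

definition grad :: "('a::real_inner \<Rightarrow> real) \<Rightarrow> 'a \<Rightarrow> 'a" where
  "grad f x = (THE D. GDERIV f x :> D)"

lemma grad_eqI:
  assumes "GDERIV f x :> D"
  shows "grad f x = D"
  unfolding grad_def
proof (rule the_equality)
  fix D' assume "GDERIV f x :> D'"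
  then have "(\<lambda>h. h \<bullet> D') = (\<lambda>h. h \<bullet> D)"
    using assms unfolding gderiv_def by (rule has_derivative_unique)
  then show "D' = D"
    by (metis vector_eq_ldot)
qed (fact assms)

definition cont_differentiable :: "('a::real_inner \<Rightarrow> real) \<Rightarrow> bool" where
  "cont_differentiable f \<longleftrightarrow>
     (\<exists>D. (\<forall>x. GDERIV f x :> D x) \<and> continuous_on UNIV D)"

end

theory Submission
  imports Defs
begin

text \<open>
  Follow the segment \<open>X\<^sub>n - s \<Delta>t \<nabla>\<Psi>(X\<^sub>n)\<close>, \<open>0 \<le> s \<le> 1\<close>, up to the first parameter at which
  some distance is \<open>\<le> r\<close>. Before it the segment is admissible, so the Lipschitz bound and
  \<open>L \<Delta>t \<le> 1\<close> make \<open>\<Psi>\<close> nonincreasing along it. At the first bad parameter some distance equals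
  \<open>r\<close> and contributes at least \<open>G\<^sub>0 \<phi>(r) > E\<^sub>0\<close> to \<open>\<Psi>\<close>, a contradiction. Hence the whole step
  stays admissible and \<open>\<Psi>(X\<^sub>n\<^sub>+\<^sub>1) \<le> \<Psi>(X\<^sub>n)\<close>.
\<close>

section \<open>Gradients and the admissible set\<close>

text \<open>In finite dimension the derivative is a linear functional, and its Riesz representative
  is \<open>adjoint f' 1\<close>. This supplies the existence that the definite description in
  \<open>grad\<close> leaves open.\<close>

lemma GDERIV_grad:
  fixes f :: "'a::euclidean_space \<Rightarrow> real"
  assumes "f differentiable (at x)"
  shows "GDERIV f x :> grad f x"
proof -
  obtain f' where f': "(f has_derivative f') (at x)"
    using assms unfolding differentiable_def by blast
  have "linear f'"
    using f' has_derivative_linear by blast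
  then have "f' = (\<lambda>h. h \<bullet> adjoint f' 1)"
    by (simp add: fun_eq_iff adjoint_works)
  then have "GDERIV f x :> adjoint f' 1"
    using f' unfolding gderiv_def by simp
  then show ?thesis
    using grad_eqI by metis
qed

lemma robot_pairs_nonempty:
  assumes "CARD('n::finite) > 1"
  shows "(robot_pairs :: ('n \<times> 'n) set) \<noteq> {}"
proof -
  have "\<not> (\<forall>i j :: 'n. i = j)"
    using assms is_singletonI'[of "UNIV :: 'n set"] by (auto simp: is_singleton_altdef)
  then show ?thesis
    unfolding robot_pairs_def by auto
qed

text \<open>The index set is finite and, with at least two robots, nonempty, so the infimum is
  attained and strict bounds pass through it. A general \<open>f\<close> covers both distances and
  squared distances.\<close>

lemma less_INF_robot_pairs_iff:
  fixes f :: "'n::finite \<Rightarrow> 'n \<Rightarrow> real"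
  assumes "CARD('n) > 1"
  shows "a < (INF (i, j) \<in> robot_pairs. f i j) \<longleftrightarrow> (\<forall>i j. j \<noteq> i \<longrightarrow> a < f i j)"
proof -
  have "a < (INF p \<in> robot_pairs. case_prod f p) \<longleftrightarrow> (\<forall>x \<in> case_prod f ` robot_pairs. a < x)"
    using robot_pairs_nonempty[OF assms] by (intro finite_less_Inf_iff) simp_all
  then show ?thesis
    unfolding robot_pairs_def by auto
qed

lemma admissible_iff:
  fixes X :: "'n::finite config"
  assumes "CARD('n) > 1"
  shows "X \<in> admissible M r \<longleftrightarrow>
    (\<forall>i. X $ i \<in> Omega M) \<and> (\<forall>i j. j \<noteq> i \<longrightarrow> r < norm (X $ i - X $ j))"
  unfolding admissible_def less_INF_robot_pairs_iff[OF assms] by simp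

lemma convex_Omega: "convex (Omega M)"
proof -
  have "Omega M = cbox (\<chi> k. -M) (\<chi> k. M)"
    unfolding Omega_def by (auto simp: mem_box_cart)
  then show ?thesis
    by simp
qed

section \<open>Smoothness and lower bound of the potential\<close>

text \<open>The cutoff can only spoil differentiability at \<open>R\<close>. There the two limits
  force \<phi> and its derivative to vanish, so \<phi> is glued to the zero function with matching
  value and slope.\<close>

lemma truncation_differentiable:
  fixes \<phi> :: "real \<Rightarrow> real"
  assumes C1: "\<phi> C1_differentiable_on {0<..}"
    and R: "0 < R"
    and lim: "(\<phi> \<longlongrightarrow> 0) (at_left R)"
    and lim': "(deriv \<phi> \<longlongrightarrow> 0) (at_left R)"
    and d: "0 < d"
  shows "(\<lambda>x. if x < R then \<phi> x else 0) differentiable (at d)"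
proof -
  obtain D where D: "\<And>x. 0 < x \<Longrightarrow> (\<phi> has_vector_derivative D x) (at x)"
    and contD: "continuous_on {0<..} D"
    using C1 unfolding C1_differentiable_on_def by auto
  have DERIV: "(\<phi> has_real_derivative D x) (at x)" if "0 < x" for x
    using D[OF that] by (simp add: has_real_derivative_iff_has_vector_derivative)
  consider "d < R" | "d > R" | "d = R"
    by linarith
  then show ?thesis
  proof cases
    case 1
    have "((\<lambda>x. if x < R then \<phi> x else 0) has_real_derivative D d) (at d)"
      by (rule has_field_derivative_transform_within_open[OF DERIV[OF d], of "{..<R}"])
        (use 1 in auto)
    then show ?thesis
      unfolding real_differentiable_def by (rule exI)
  next
    case 2
    have "((\<lambda>x. if x < R then \<phi> x else 0) has_real_derivative 0) (at d)"
      by (rule has_field_derivative_transform_within_open[where f = "\<lambda>_. 0" and S = "{R<..}"])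
        (use 2 in auto)
    then show ?thesis
      unfolding real_differentiable_def by (rule exI)
  next
    case 3
    have "(\<phi> \<longlongrightarrow> \<phi> R) (at_left R)"
      using DERIV_isCont[OF DERIV[OF R]] unfolding isCont_def
      by (rule filterlim_mono[OF _ order_refl]) (simp add: at_le)
    then have \<phi>R: "\<phi> R = 0"
      using tendsto_unique[OF _ _ lim] by simp
    have "isCont D R"
      using contD R by (simp add: continuous_on_eq_continuous_at)
    then have "(D \<longlongrightarrow> D R) (at_left R)"
      unfolding isCont_def by (rule filterlim_mono[OF _ order_refl]) (simp add: at_le)
    \<comment> \<open>The limit is assumed for \<open>deriv \<phi>\<close>, while continuity is
      known for the derivative \<open>D\<close> given by the C1 hypothesis; the two agree to the
      left of \<open>R\<close>.\<close>
    moreover have "eventually (\<lambda>x. D x = deriv \<phi> x) (at_left R)"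
      using eventually_at_left_real[OF R]
      by eventually_elim (use DERIV DERIV_imp_deriv in \<open>metis greaterThanLessThan_iff\<close>)
    ultimately have "(deriv \<phi> \<longlongrightarrow> D R) (at_left R)"
      using tendsto_cong by fast
    then have DR: "D R = 0"
      using tendsto_unique[OF _ _ lim'] by simp
    have "((\<lambda>x. \<phi> x / (x - R)) \<longlongrightarrow> 0) (at R)"
      using DERIV[OF R] \<phi>R DR by (simp add: has_field_derivative_iff)
    \<comment> \<open>The truncated quotient is either 0 or the quotient of \<phi>, hence dominated
      by the latter in absolute value.\<close>
    then have "((\<lambda>x. (if x < R then \<phi> x else 0) / (x - R)) \<longlongrightarrow> 0) (at R)"
      by (rule tendsto_0_le[where K = 1]) simp
    then have "((\<lambda>x. if x < R then \<phi> x else 0) has_real_derivative 0) (at R)"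
      by (simp add: has_field_derivative_iff)
    then show ?thesis
      unfolding 3 by (auto simp: real_differentiable_def)
  qed
qed

lemma potential_differentiable:
  fixes F :: "'n::finite config \<Rightarrow> real"
  assumes F: "F differentiable (at X)"
    and \<phi>: "\<And>d. 0 < d \<Longrightarrow> (\<lambda>x. if x < R then \<phi> x else 0) differentiable (at d)"
    and X: "\<And>i j. j \<noteq> i \<Longrightarrow> X $ i \<noteq> X $ j"
  shows "potential F G0 R \<phi> differentiable (at X)"
proof -
  define \<psi> where "\<psi> = (\<lambda>x. if x < R then \<phi> x else 0)"
  have pair: "(\<lambda>Y :: 'n config. \<psi> (norm (Y $ i - Y $ j))) differentiable (at X)" if "j \<noteq> i" for i j
  proof -
    have "bounded_linear (\<lambda>Y :: 'n config. Y $ i - Y $ j)"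
      by (intro bounded_linear_sub bounded_linear_vec_nth)
    then have "(\<lambda>Y :: 'n config. Y $ i - Y $ j) differentiable (at X)"
      by (rule bounded_linear_imp_differentiable)
    moreover have "norm differentiable (at (X $ i - X $ j))"
      using X[OF that] by (intro differentiable_norm_at) simp
    ultimately have "(norm \<circ> (\<lambda>Y :: 'n config. Y $ i - Y $ j)) differentiable (at X)"
      by (rule differentiable_chain_at)
    moreover have "\<psi> differentiable (at ((norm \<circ> (\<lambda>Y. Y $ i - Y $ j)) X))"
      using \<phi> X[OF that] by (simp add: \<psi>_def)
    ultimately have "(\<psi> \<circ> (norm \<circ> (\<lambda>Y :: 'n config. Y $ i - Y $ j))) differentiable (at X)"
      by (rule differentiable_chain_at)
    then show ?thesis
      by (simp add: o_def)
  qed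
  \<comment> \<open>The cutoff moves from the index set into the summand \<psi>, so that the sums
    range over sets independent of the configuration and can be differentiated term by term.\<close>
  have "potential F G0 R \<phi> =
    (\<lambda>Y. F Y + G0 * (\<Sum>i\<in>UNIV. \<Sum>j\<in>{j. j \<noteq> i}. \<psi> (norm (Y $ i - Y $ j))))"
    unfolding potential_def repelling_def \<psi>_def
    by (intro ext arg_cong2[where f = "(+)"] arg_cong2[where f = "(*)"] refl sum.cong
        sum.mono_neutral_cong_left) auto
  moreover have "(\<lambda>Y. F Y + G0 * (\<Sum>i\<in>UNIV. \<Sum>j\<in>{j. j \<noteq> i}. \<psi> (norm (Y $ i - Y $ j))))
    differentiable (at X)"
    using F pair by (intro derivative_intros differentiable_sum) auto
  ultimately show ?thesis
    by simp
qed

lemma potential_ge_pair: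
  fixes X :: "'n::finite config"
  assumes G0: "0 \<le> G0" and F: "0 \<le> F X"
    and nonneg: "\<And>x. 0 < x \<Longrightarrow> x < R \<Longrightarrow> 0 \<le> \<phi> x"
    and X: "\<And>i j. j \<noteq> i \<Longrightarrow> X $ i \<noteq> X $ j"
    and ij: "j \<noteq> i" "norm (X $ i - X $ j) < R"
  shows "G0 * \<phi> (norm (X $ i - X $ j)) \<le> potential F G0 R \<phi> X"
proof -
  let ?S = "\<lambda>i. \<Sum>j\<in>{j. j \<noteq> i \<and> norm (X $ i - X $ j) < R}. \<phi> (norm (X $ i - X $ j))"
  have term_nonneg: "0 \<le> \<phi> (norm (X $ i - X $ j))" if "j \<noteq> i \<and> norm (X $ i - X $ j) < R" for i j
    using that X by (intro nonneg) auto
  have "\<phi> (norm (X $ i - X $ j)) \<le> ?S i"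
    using ij term_nonneg by (intro member_le_sum) auto
  also have "\<dots> \<le> (\<Sum>i\<in>UNIV. ?S i)"
    using term_nonneg by (intro member_le_sum sum_nonneg) auto
  finally show ?thesis
    using G0 F by (simp add: potential_def repelling_def mult_left_mono add_increasing)
qed

section \<open>Descent and first contact along one step\<close>

text \<open>With \<open>g = grad f x\<close>, the slope of \<open>f\<close> along the segment is
  -\<tau> times the inner product of \<open>g\<close> with the current gradient. The Lipschitz bound
  keeps that gradient within \<open>norm g\<close> of \<open>g\<close>, so Cauchy-Schwarz makes the
  inner product nonnegative. The range \<open>{0..<t}\<close> allows the endpoint to lie outside
  \<open>A\<close>, as it does at a first contact.\<close>

lemma gradient_step_nonincreasing:
  fixes f :: "'a::euclidean_space \<Rightarrow> real"
  assumes diff: "\<And>s. s \<in> {0..t} \<Longrightarrow> f differentiable (at (x - (s * \<tau>) *\<^sub>R grad f x))"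
    and Lip: "L-lipschitz_on A (grad f)"
    and A: "\<And>s. s \<in> {0..<t} \<Longrightarrow> x - (s * \<tau>) *\<^sub>R grad f x \<in> A"
    and \<tau>: "0 \<le> \<tau>" "L * \<tau> \<le> 1"
    and t: "0 \<le> t" "t \<le> 1"
  shows "f (x - (t * \<tau>) *\<^sub>R grad f x) \<le> f x"
proof -
  define g where "g = grad f x"
  define p where "p = (\<lambda>s. x - (s * \<tau>) *\<^sub>R g)"
  have deriv: "((\<lambda>s. f (p s)) has_real_derivative - (\<tau> * (g \<bullet> grad f (p s)))) (at s)"
    if "s \<in> {0..t}" for s
  proof -
    have "(p has_derivative (\<lambda>h. - ((h * \<tau>) *\<^sub>R g))) (at s)"
      unfolding p_def by (auto intro!: derivative_eq_intros)
    moreover have "(f has_derivative (\<lambda>h. h \<bullet> grad f (p s))) (at (p s))"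
      using GDERIV_grad[OF diff[OF that]] by (simp add: gderiv_def p_def g_def)
    ultimately have "((\<lambda>s. f (p s)) has_derivative (\<lambda>h. - ((h * \<tau>) *\<^sub>R g) \<bullet> grad f (p s))) (at s)"
      by (rule has_derivative_compose)
    then show ?thesis
      unfolding has_field_derivative_def by (rule has_derivative_eq_rhs) (simp add: fun_eq_iff)
  qed
  have slope: "0 \<le> g \<bullet> grad f (p s)" if s: "0 < s" "s < t" for s
  proof -
    have "norm (grad f (p 0) - grad f (p s)) \<le> L * norm (p 0 - p s)"
      using lipschitz_onD[OF Lip A A, of 0 s] s by (simp add: dist_norm p_def g_def)
    also have "\<dots> = (L * \<tau>) * s * norm g"
      using s \<tau> by (simp add: p_def)
    also have "\<dots> \<le> 1 * 1 * norm g"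
      using s \<tau> t lipschitz_on_nonneg[OF Lip] by (intro mult_mono) auto
    finally have "norm (g - grad f (p s)) \<le> norm g"
      by (simp add: p_def g_def)
    then have "norm g * norm (g - grad f (p s)) \<le> norm g * norm g"
      by (simp add: mult_left_mono)
    then have "g \<bullet> (g - grad f (p s)) \<le> g \<bullet> g"
      using norm_cauchy_schwarz[of g "g - grad f (p s)"]
      by (simp add: power2_norm_eq_inner flip: power2_eq_square)
    then show ?thesis
      by (simp add: inner_diff_right)
  qed
  \<comment> \<open>The sign of the slope is known on the open interval; continuity extends the
    comparison to both ends.\<close>
  have "f (p t) \<le> f (p 0)"
  proof (rule DERIV_nonpos_imp_decreasing_open[OF t(1)])
    fix s assume s: "0 < s" "s < t"
    show "\<exists>y. ((\<lambda>s. f (p s)) has_real_derivative y) (at s) \<and> y \<le> 0"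
      using deriv[of s] slope[OF s] s \<tau> by (intro exI[of _ "- (\<tau> * (g \<bullet> grad f (p s)))"]) simp
  next
    show "continuous_on {0..t} (\<lambda>s. f (p s))"
      using deriv by (intro DERIV_continuous_on) (blast intro: has_field_derivative_at_within)
  qed
  then show ?thesis
    by (simp add: p_def g_def)
qed

text \<open>The bad parameters form a finite union of closed sets in \<open>{0..1}\<close>, hence a
  compact set, which has a least element \<open>t\<close>. Minimality gives the strict bounds before
  \<open>t\<close>, and continuity gives the weak bounds at \<open>t\<close>, with equality for a
  distance that is bad there.\<close>

lemma first_entry_point:
  fixes d :: "'b::finite \<Rightarrow> real \<Rightarrow> real"
  assumes cont: "\<And>b. continuous_on {0..1} (d b)"
    and start: "\<And>b. b \<in> B \<Longrightarrow> r < d b 0"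
    and bad: "s \<in> {0..1}" "b \<in> B" "d b s \<le> r"
  obtains t b where "0 < t" "t \<le> 1" "b \<in> B" "d b t = r"
    "\<forall>b\<in>B. r \<le> d b t" "\<forall>s\<in>{0..<t}. \<forall>b\<in>B. r < d b s"
proof -
  define S where "S = (\<Union>b\<in>B. {s \<in> {0..1}. d b s \<le> r})"
  have "closed {s \<in> {0..1}. d b s \<le> r}" for b
    by (rule continuous_on_closed_Collect_le[OF cont]) auto
  then have "closed S"
    unfolding S_def by (intro closed_UN) auto
  moreover have "bounded S"
    by (rule bounded_subset[of "{0..1}"]) (auto simp: S_def)
  ultimately have "compact S"
    by (simp add: compact_eq_bounded_closed)
  moreover have "S \<noteq> {}"
    using bad unfolding S_def by blast
  ultimately obtain t where t: "t \<in> S" "\<And>s. s \<in> S \<Longrightarrow> t \<le> s"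
    using compact_attains_inf by metis
  obtain b where b: "b \<in> B" "d b t \<le> r" and t01: "0 \<le> t" "t \<le> 1"
    using t(1) unfolding S_def by auto
  have "t \<noteq> 0"
    using start[OF b(1)] b(2) by auto
  then have "0 < t"
    using t01 by simp
  have before: "r < d b s" if "s \<in> {0..<t}" "b \<in> B" for s b
  proof (rule ccontr)
    assume "\<not> r < d b s"
    then have "s \<in> S"
      using that t01 unfolding S_def by (auto simp: not_less intro!: bexI[of _ b])
    then show False
      using t(2) that by fastforce
  qed
  \<comment> \<open>As \<open>0 < t\<close>, the point \<open>t\<close> is a limit of earlier
    parameters, where the strict bound holds.\<close>
  have at: "r \<le> d b t" if "b \<in> B" for b
  proof (rule continuous_ge_on_closure[of "{0..<t}" "d b"])
    show "continuous_on (closure {0..<t}) (d b)"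
      using cont[of b] by (rule continuous_on_subset) (use t01 \<open>0 < t\<close> in simp)
    show "t \<in> closure {0..<t}"
      using \<open>0 < t\<close> by simp
    show "r \<le> d b s" if "s \<in> {0..<t}" for s
      using before[OF that \<open>b \<in> B\<close>] by simp
  qed
  show thesis
    using that[OF \<open>0 < t\<close> t01(2) b(1) antisym[OF b(2) at[OF b(1)]]] at before by blast
qed

section \<open>Sign of the interaction and invariance along the trajectory\<close>

text \<open>By monotonicity \<open>\<phi> x\<close> bounds the values on the interval from
  \<open>x\<close> to \<open>R\<close>, hence also their limit 0.\<close>

lemma antimono_on_nonneg_of_limit:
  fixes \<phi> :: "real \<Rightarrow> real"
  assumes mono: "antimono_on {0<..} \<phi>" and lim: "(\<phi> \<longlongrightarrow> 0) (at_left R)"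
    and x: "0 < x" "x < R"
  shows "0 \<le> \<phi> x"
proof (rule tendsto_upperbound[OF lim])
  show "eventually (\<lambda>y. \<phi> y \<le> \<phi> x) (at_left R)"
    using eventually_at_left_real[OF x(2)]
    by eventually_elim (use x in \<open>auto intro: monotone_onD[OF mono]\<close>)
qed simp

theorem corollary6p3:
  fixes F :: "real ^ 2 ^ 'n::finite \<Rightarrow> real"
    and target :: "(real ^ 2 ^ 'n) set"
    and \<phi> :: "real \<Rightarrow> real"
    and r R G0 M L \<Delta>t :: real
    and X0 :: "real ^ 2 ^ 'n"
    and X :: "nat \<Rightarrow> real ^ 2 ^ 'n"
  assumes N: "CARD('n) > 1"
    and constants: "0 < r" "r < R" "0 < G0" "0 < M"
    and F_nonneg: "\<And>Y. 0 \<le> F Y"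
    and F_C1: "cont_differentiable F"
    and F_bounded: "bounded (F ` Omega_configs M)"
    and F_attains_min: "\<exists>Y. is_arg_min F (\<lambda>_. True) Y"
    and F_min_in_target: "\<And>Y. is_arg_min F (\<lambda>_. True) Y \<Longrightarrow> Y \<in> target"
    and \<phi>_C1: "\<phi> C1_differentiable_on {0<..}"
    and \<phi>_decreasing: "antimono_on {0<..} \<phi>"
    and \<phi>_lim: "(\<phi> \<longlongrightarrow> 0) (at_left R)"
    and \<phi>'_lim: "(deriv \<phi> \<longlongrightarrow> 0) (at_left R)"
    and X0: "X0 \<in> admissible M r"
    and E0: "potential F G0 R \<phi> X0 < G0 * \<phi> r"
    and L: "0 < L"
    and Lipschitz: "L-lipschitz_on (admissible M r) (grad (potential F G0 R \<phi>))"
    and \<Delta>t: "0 < \<Delta>t" "\<Delta>t \<le> 1 / L"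
    and X_0: "X 0 = X0"
    and X_Suc: "\<And>n i. X (Suc n) $ i = X n $ i - \<Delta>t *\<^sub>R (grad (potential F G0 R \<phi>) (X n) $ i)"
    and X_Omega: "\<And>n i. X n $ i \<in> Omega M"
  shows "\<forall>n. (INF (i, j) \<in> robot_pairs. (norm (X n $ i - X n $ j))\<^sup>2) > r\<^sup>2"
proof -
  let ?\<Psi> = "potential F G0 R \<phi>"
  have diff: "?\<Psi> differentiable (at Y)" if "\<And>i j. j \<noteq> i \<Longrightarrow> Y $ i \<noteq> Y $ j" for Y
  proof (rule potential_differentiable)
    show "F differentiable (at Y)"
      using F_C1 unfolding cont_differentiable_def gderiv_def differentiable_def by blast
    show "(\<lambda>x. if x < R then \<phi> x else 0) differentiable (at d)" if "0 < d" for d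
      using constants that by (intro truncation_differentiable[OF \<phi>_C1 _ \<phi>_lim \<phi>'_lim]) auto
  qed (use that in auto)
  have step: "X (Suc n) \<in> admissible M r \<and> ?\<Psi> (X (Suc n)) \<le> ?\<Psi> (X n)"
    if adm: "X n \<in> admissible M r" and E: "?\<Psi> (X n) < G0 * \<phi> r" for n
  proof -
    let ?p = "\<lambda>s. X n - (s * \<Delta>t) *\<^sub>R grad ?\<Psi> (X n)"
    let ?d = "\<lambda>(i, j) s. norm (?p s $ i - ?p s $ j)"
    have p1: "?p 1 = X (Suc n)"
      by (simp add: vec_eq_iff X_Suc)
    \<comment> \<open>Each intermediate configuration is a convex combination of two iterates, both
      in the square, so convexity keeps the whole segment there.\<close>
    have "?p s = (1 - s) *\<^sub>R X n + s *\<^sub>R X (Suc n)" for s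
      unfolding p1[symmetric] by (simp add: algebra_simps)
    then have Omega: "?p s $ i \<in> Omega M" if "s \<in> {0..1}" for s i
      using convexD_alt[OF convex_Omega X_Omega[of n i] X_Omega[of "Suc n" i], of s] that by simp
    \<comment> \<open>The parameter \<open>t\<close> is left general because the estimate is applied
      twice: at the first contact, for the contradiction, and at \<open>t = 1\<close>, for the
      energy of the next iterate.\<close>
    have decrease: "?\<Psi> (?p t) \<le> ?\<Psi> (X n)"
      if t: "0 \<le> t" "t \<le> 1"
        and before: "\<forall>s\<in>{0..<t}. \<forall>b\<in>robot_pairs. r < ?d b s"
        and at: "\<forall>b\<in>robot_pairs. r \<le> ?d b t" for t
    proof (rule gradient_step_nonincreasing[OF _ Lipschitz])
      show "?\<Psi> differentiable (at (?p s))" if "s \<in> {0..t}" for s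
      \<comment> \<open>Distances are at least \<open>r > 0\<close> up to and including
        \<open>t\<close>, so no two robots coincide and the potential is differentiable
        there.\<close>
      proof (rule diff)
        fix i j :: 'n assume "j \<noteq> i"
        then have "r \<le> ?d (i, j) s"
          using bspec[OF bspec[OF before, of s], of "(i, j)"] bspec[OF at, of "(i, j)"] that
          by (cases "s = t") (auto simp: robot_pairs_def)
        then show "?p s $ i \<noteq> ?p s $ j"
          using constants by auto
      qed
      show "?p s \<in> admissible M r" if "s \<in> {0..<t}" for s
        unfolding admissible_iff[OF N]
        using bspec[OF before that] Omega[of s] t that by (auto simp: robot_pairs_def)
      show "L * \<Delta>t \<le> 1"
        using \<Delta>t L by (simp add: field_simps)
    qed (use \<Delta>t t in auto)
    have good: "r < ?d b s" if "s \<in> {0..1}" "b \<in> robot_pairs" for s b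
    proof (rule ccontr)
      assume "\<not> r < ?d b s"
      then have entered: "?d b s \<le> r"
        by simp
      have cont: "continuous_on {0..1} (?d b)" for b
        by (cases b) (auto intro!: continuous_intros)
      have start: "r < ?d b 0" if "b \<in> robot_pairs" for b
        using adm that unfolding admissible_iff[OF N] by (auto simp: robot_pairs_def)
      obtain t b where t: "0 < t" "t \<le> 1" and b: "b \<in> robot_pairs" "?d b t = r"
        and at: "\<forall>b\<in>robot_pairs. r \<le> ?d b t"
        and before: "\<forall>s\<in>{0..<t}. \<forall>b\<in>robot_pairs. r < ?d b s"
        by (rule first_entry_point[of ?d robot_pairs r s b,
          OF cont start \<open>s \<in> {0..1}\<close> \<open>b \<in> robot_pairs\<close> entered])
      obtain i j where ij: "j \<noteq> i" "norm (?p t $ i - ?p t $ j) = r"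
        using b unfolding robot_pairs_def by auto
      \<comment> \<open>The touching pair is at distance \<open>r < R\<close>, so it lies inside the
        cutoff and its term is counted in the potential.\<close>
      have "G0 * \<phi> r \<le> ?\<Psi> (?p t)"
      proof (subst (1) ij(2)[symmetric], rule potential_ge_pair[where F = F])
        show "?p t $ i \<noteq> ?p t $ j" if "j \<noteq> i" for i j
          using bspec[OF at, of "(i, j)"] that constants by (auto simp: robot_pairs_def)
        show "0 \<le> \<phi> x" if "0 < x" "x < R" for x
          using antimono_on_nonneg_of_limit[OF \<phi>_decreasing \<phi>_lim that] .
      qed (use constants F_nonneg ij in auto)
      also have "\<dots> \<le> ?\<Psi> (X n)"
        using decrease[OF _ t(2) before at] t by simp
      finally show False
        using E by simp
    qed
    have "?\<Psi> (?p 1) \<le> ?\<Psi> (X n)"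
      by (rule decrease) (use good good[of 1] in \<open>force+\<close>)
    moreover have "X (Suc n) \<in> admissible M r"
      unfolding admissible_iff[OF N] using good[of 1] Omega[of 1] by (auto simp: robot_pairs_def X_Suc)
    ultimately show ?thesis
      unfolding p1 by simp
  qed
  \<comment> \<open>Admissibility alone does not propagate: the strict energy bound must be carried
    along, as it is what excludes contact in the next step.\<close>
  have inv: "X n \<in> admissible M r \<and> ?\<Psi> (X n) < G0 * \<phi> r" for n
  proof (induction n)
    case 0
    then show ?case
      using X0 E0 X_0 by simp
  next
    case (Suc n)
    then show ?case
      using step[of n] by linarith
  qed
  \<comment> \<open>The infimum criterion is now applied to squared distances; squaring preserves
    the strict bounds because \<open>r\<close> is positive.\<close>
  show ?thesis
    unfolding less_INF_robot_pairs_iff[OF N]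
    using inv constants unfolding admissible_iff[OF N] by (auto intro!: power_strict_mono)
qed

end
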